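(* Let $\mathcal T^h$ be a Voronoi mesh for $\Omega$, $\kappa,\delta t>0$, and let $W:\mathbb R^d\to\mathbb R$ satisfy $W(x)=W(-x)\ge 0$, $W\in C^1(\mathbb R^d\setminus\{0\})$, and $W$ Lipschitz with Lipschitz constant $\mathrm{Lip}(W)$. Assume $\frac{|\partial K|}{|K|}\le\frac{C_{\rm iso}}{h}$ for all $K\in\mathcal T^h$. Let $\{\rho^n_K\}_{K,n}$ be a solution to the Scharfetter--Gummel scheme with initial datum $\rho^0\in\mathcal P(\mathcal T^h)$, and suppose that $$h\le\frac{\kappa}{\mathrm{Lip}(W)},\qquad 64\,C_{\rm iso}\frac{\mathrm{Lip}(W)^2\mathcal F^h(\rho^0)}{\kappa^2}\,\delta t+512\,C_{\rm iso}^2\frac{\mathrm{Lip}(W)^4}{\kappa^2}(\delta t)^2\le1,\qquad \delta t\,\frac{\mathrm{Lip}(W)^2}{\kappa}\le\frac38 .$$ Let $\varPi^h\subset\mathcal P(\mathcal T^h)$ be the set of stationary solutions of the scheme. Then $\rho^n$ approaches $\varPi^h$ in the large time limit, $$\lim_{n\to\infty}\mathrm{dist}_{\ell^1(\mathcal T^h)}(\rho^n,\varPi^h)=0 .$$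
   Context: Mesh. $\Omega\subset\mathbb R^d$ is a bounded domain with smooth boundary. A Voronoi mesh $\mathcal T^h$ for $\Omega$ is a finite family of cells of a Voronoi tesselation that covers $\Omega$, such that each cell $K$ is compact, $K\cap\Omega\neq\emptyset$ and $\mathrm{diam}(K)\le h$. The generator of $K$ is $x_K\in K$, and $d_{KL}=|x_K-x_L|$. Two distinct cells $K,L\in\mathcal T^h$ are neighbors, $L\sim K$, if they share a face $K|L=K\cap L$ of positive $(d-1)$-dimensional area $|K|L|$; $\tau_{KL}=|K|L|/d_{KL}$. $|K|$ is the volume of $K$ and $|\partial K|$ its surface area. $\mathcal P(\mathcal T^h)=\{\{\rho_K\}_{K\in\mathcal T^h}:\rho_K\ge 0\ \forall K,\ \sum_K|K|\rho_K=1\}$; $\|\rho\|_{\ell^1(\mathcal T^h)}=\sum_K|K||\rho_K|$ and $\mathrm{dist}_{\ell^1(\mathcal T^h)}$ is the corresponding distance to a set. Scheme. Let $B_\kappa(s)=\frac{s}{e^{s/\kappa}-1}$ for $s\neq0$ and $B_\kappa(0)=\kappa$. A solution of the Scharfetter--Gummel scheme is a sequence $(\rho^n)_{n\ge0}$ such that for all $n\ge 0$ and $K\in\mathcal T^h$ $$|K|\frac{\rho_K^{n+1}-\rho_K^n}{\delta t}+\sum_{L\sim K}F_{KL}^{n+1}=0,\qquad F_{KL}^{n+1}=\tau_{KL}\big(B_\kappa(d_{KL}q_{LK}^{n+1})\rho_K^{n+1}-B_\kappa(d_{KL}q_{KL}^{n+1})\rho_L^{n+1}\big),$$ $$q_{KL}^{n+1}=\sum_{J\in\mathcal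 T^h}|J|\,\frac{\rho_J^{n+1}+\rho_J^n}{2}\,\frac{W(x_K-x_J)-W(x_L-x_J)}{d_{KL}}.$$ Stationary solutions: $\rho\in\mathcal P(\mathcal T^h)$ such that the constant sequence $\rho^n=\rho$ solves the scheme, i.e. $\sum_{L\sim K}F_{KL}=0$ for all $K$ when $\rho^{n+1}=\rho^n=\rho$. Discrete free energy: $\mathcal F^h(\rho)=\kappa\sum_K|K|\rho_K\log\rho_K+\frac12\sum_{K,L}|K||L|W(x_K-x_L)\rho_K\rho_L$ ($0\log0=0$). *)

theory Defs
  imports "HOL-Analysis.Analysis"
begin

text \<open>\<open>Ck_on k f U\<close>: class \<open>C\<^sup>k\<close> on an open set \<open>U\<close> of a finite-dimensional space, by iterated
  directional derivatives (continuity of all first-order directional derivatives is there the same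
  as continuity of the total derivative).\<close>

primrec Ck_on :: "nat \<Rightarrow> ('a::euclidean_space \<Rightarrow> real) \<Rightarrow> 'a set \<Rightarrow> bool" where
  "Ck_on 0 f U \<longleftrightarrow> continuous_on U f"
| "Ck_on (Suc k) f U \<longleftrightarrow>
     f differentiable_on U \<and> (\<forall>v. Ck_on k (\<lambda>x. frechet_derivative f (at x) v) U)"

definition smooth_on :: "('a::euclidean_space \<Rightarrow> real) \<Rightarrow> 'a set \<Rightarrow> bool" where
  "smooth_on f U \<longleftrightarrow> (\<forall>k. Ck_on k f U)"

text \<open>The boundary is smooth if \<open>\<Omega>\<close> is locally the strict sublevel set of a smooth function
  without critical points.\<close>

definition smooth_boundary :: "'a::euclidean_space set \<Rightarrow> bool" where
  "smooth_boundary \<Omega> \<longleftrightarrow>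
     (\<forall>p\<in>frontier \<Omega>. \<exists>U \<phi>. open U \<and> p \<in> U \<and> smooth_on \<phi> U \<and>
        (\<forall>x\<in>U. \<exists>v. frechet_derivative \<phi> (at x) v \<noteq> 0) \<and>
        \<Omega> \<inter> U = {x\<in>U. \<phi> x < 0})"

definition bounded_smooth_domain :: "'a::euclidean_space set \<Rightarrow> bool" where
  "bounded_smooth_domain \<Omega> \<longleftrightarrow>
     open \<Omega> \<and> connected \<Omega> \<and> \<Omega> \<noteq> {} \<and> bounded \<Omega> \<and> smooth_boundary \<Omega>"

text \<open>The optimal Lipschitz constant; meaningful only for Lipschitz functions.\<close>

definition Lip :: "('a::euclidean_space \<Rightarrow> real) \<Rightarrow> real" where
  "Lip W = Inf {C. C-lipschitz_on UNIV W}"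

abbreviation vol :: "'a::euclidean_space set \<Rightarrow> real" where
  "vol K \<equiv> measure lebesgue K"

text \<open>\<open>k\<close>-dimensional Hausdorff measure, normalised to agree with Lebesgue measure. Empty
  covering sets contribute 0 also for \<open>k = 0\<close>, where nonempty ones contribute 1, so that the
  0-dimensional measure is the counting measure.\<close>

definition hausdorff_content :: "nat \<Rightarrow> real \<Rightarrow> 'a::euclidean_space set \<Rightarrow> ennreal" where
  "hausdorff_content k \<delta> A =
     (INF U \<in> {U :: nat \<Rightarrow> 'a set. A \<subseteq> (\<Union>i. U i) \<and> (\<forall>i. bounded (U i) \<and> diameter (U i) \<le> \<delta>)}.
        \<Sum>i. if U i = {} then 0
             else ennreal (unit_ball_vol (real k) * (diameter (U i) / 2) ^ k))"

definition hausdorff_measure :: "nat \<Rightarrow> 'a::euclidean_space set \<Rightarrow> ennreal" where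
  "hausdorff_measure k A = (SUP \<delta> \<in> {0<..}. hausdorff_content k \<delta> A)"

text \<open>The \<open>(d-1)\<close>-dimensional area. It is applied only to boundaries of compact convex cells and
  subsets of these, whose Hausdorff measure is finite.\<close>

definition area :: "'a::euclidean_space set \<Rightarrow> real" where
  "area A = enn2real (hausdorff_measure (DIM('a) - 1) A)"

definition voronoi_cell :: "'a::euclidean_space set \<Rightarrow> 'a \<Rightarrow> 'a set" where
  "voronoi_cell G x = {y. \<forall>z\<in>G. dist y x \<le> dist y z}"

text \<open>The mesh \<open>T\<close> consists of finitely many cells of the tessellation generated by a locally
  finite set \<open>G\<close>; the latter may have further (e.g. unbounded) cells which do not belong to \<open>T\<close>.
  The generator of \<open>K\<close> is \<open>gen K\<close>.\<close>

definition voronoi_mesh ::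
  "'a::euclidean_space set \<Rightarrow> real \<Rightarrow> 'a set set \<Rightarrow> ('a set \<Rightarrow> 'a) \<Rightarrow> bool" where
  "voronoi_mesh \<Omega> h T gen \<longleftrightarrow>
     finite T \<and>
     (\<exists>G. (\<forall>r. finite (G \<inter> cball 0 r)) \<and>
          (\<forall>K\<in>T. gen K \<in> G \<and> K = voronoi_cell G (gen K))) \<and>
     \<Omega> \<subseteq> \<Union>T \<and>
     (\<forall>K\<in>T. compact K \<and> K \<inter> \<Omega> \<noteq> {} \<and> diameter K \<le> h)"

definition neighbors :: "'a::euclidean_space set set \<Rightarrow> 'a set \<Rightarrow> 'a set set" where
  "neighbors T K = {L\<in>T. L \<noteq> K \<and> area (K \<inter> L) > 0}"

definition transmission :: "('a::euclidean_space set \<Rightarrow> 'a) \<Rightarrow> 'a set \<Rightarrow> 'a set \<Rightarrow> real" where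
  "transmission gen K L = area (K \<inter> L) / dist (gen K) (gen L)"

text \<open>Discrete densities are functions on cells; only their values on \<open>T\<close> matter.\<close>

definition discrete_prob :: "'a::euclidean_space set set \<Rightarrow> ('a set \<Rightarrow> real) set" where
  "discrete_prob T = {\<rho>. (\<forall>K\<in>T. \<rho> K \<ge> 0) \<and> (\<Sum>K\<in>T. vol K * \<rho> K) = 1}"

definition l1_norm :: "'a::euclidean_space set set \<Rightarrow> ('a set \<Rightarrow> real) \<Rightarrow> real" where
  "l1_norm T \<rho> = (\<Sum>K\<in>T. vol K * \<bar>\<rho> K\<bar>)"

text \<open>Extended-real valued, so that the distance to the empty set is \<open>\<infinity>\<close> (and not 0, as for
  \<^const>\<open>infdist\<close>).\<close>

definition l1_setdist ::
  "'a::euclidean_space set set \<Rightarrow> ('a set \<Rightarrow> real) \<Rightarrow> ('a set \<Rightarrow> real) set \<Rightarrow> ennreal" where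
  "l1_setdist T \<rho> A = (INF \<sigma>\<in>A. ennreal (l1_norm T (\<lambda>K. \<rho> K - \<sigma> K)))"

definition bernoulli_fn :: "real \<Rightarrow> real \<Rightarrow> real" where
  "bernoulli_fn \<kappa> s = (if s = 0 then \<kappa> else s / (exp (s / \<kappa>) - 1))"

text \<open>In the following two definitions \<open>\<rho>\<close> is the old and \<open>\<rho>'\<close> the new time step.\<close>

definition drift ::
  "('a::euclidean_space \<Rightarrow> real) \<Rightarrow> 'a set set \<Rightarrow> ('a set \<Rightarrow> 'a) \<Rightarrow>
   ('a set \<Rightarrow> real) \<Rightarrow> ('a set \<Rightarrow> real) \<Rightarrow> 'a set \<Rightarrow> 'a set \<Rightarrow> real" where
  "drift W T gen \<rho> \<rho>' K L =
     (\<Sum>J\<in>T. vol J * ((\<rho>' J + \<rho> J) / 2) *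
        ((W (gen K - gen J) - W (gen L - gen J)) / dist (gen K) (gen L)))"

definition SG_flux ::
  "real \<Rightarrow> ('a::euclidean_space \<Rightarrow> real) \<Rightarrow> 'a set set \<Rightarrow> ('a set \<Rightarrow> 'a) \<Rightarrow>
   ('a set \<Rightarrow> real) \<Rightarrow> ('a set \<Rightarrow> real) \<Rightarrow> 'a set \<Rightarrow> 'a set \<Rightarrow> real" where
  "SG_flux \<kappa> W T gen \<rho> \<rho>' K L =
     transmission gen K L *
       (bernoulli_fn \<kappa> (dist (gen K) (gen L) * drift W T gen \<rho> \<rho>' L K) * \<rho>' K
        - bernoulli_fn \<kappa> (dist (gen K) (gen L) * drift W T gen \<rho> \<rho>' K L) * \<rho>' L)"

definition SG_solution ::
  "real \<Rightarrow> real \<Rightarrow> ('a::euclidean_space \<Rightarrow> real) \<Rightarrow> 'a set set \<Rightarrow> ('a set \<Rightarrow> 'a) \<Rightarrow>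
   (nat \<Rightarrow> 'a set \<Rightarrow> real) \<Rightarrow> bool" where
  "SG_solution \<kappa> \<delta>t W T gen \<rho> \<longleftrightarrow>
     (\<forall>n. \<forall>K\<in>T. vol K * ((\<rho> (Suc n) K - \<rho> n K) / \<delta>t)
        + (\<Sum>L\<in>neighbors T K. SG_flux \<kappa> W T gen (\<rho> n) (\<rho> (Suc n)) K L) = 0)"

definition stationary_solutions ::
  "real \<Rightarrow> real \<Rightarrow> ('a::euclidean_space \<Rightarrow> real) \<Rightarrow> 'a set set \<Rightarrow> ('a set \<Rightarrow> 'a) \<Rightarrow>
   ('a set \<Rightarrow> real) set" where
  "stationary_solutions \<kappa> \<delta>t W T gen =
     {\<rho> \<in> discrete_prob T. SG_solution \<kappa> \<delta>t W T gen (\<lambda>n. \<rho>)}"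

text \<open>Since \<open>ln 0 = 0\<close> in HOL, the convention \<open>0 log 0 = 0\<close> is automatic.\<close>

definition free_energy ::
  "real \<Rightarrow> ('a::euclidean_space \<Rightarrow> real) \<Rightarrow> 'a set set \<Rightarrow> ('a set \<Rightarrow> 'a) \<Rightarrow> ('a set \<Rightarrow> real) \<Rightarrow> real" where
  "free_energy \<kappa> W T gen \<rho> =
     \<kappa> * (\<Sum>K\<in>T. vol K * \<rho> K * ln (\<rho> K))
     + 1 / 2 * (\<Sum>K\<in>T. \<Sum>L\<in>T. vol K * vol L * W (gen K - gen L) * \<rho> K * \<rho> L)"

end

theory Submission
  imports Defs
begin

text \<open>The scheme is a gradient flow of the free energy: since \<open>B(-s) = exp (s/\<kappa>)
  B(s)\<close>, the flux through \<open>K|L\<close> has the sign of the jump of \<open>\<kappa> ln \<rho>' +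
  V\<close>, where \<open>V\<close> is the potential generated by the midpoint density. Convexity of the entropy
  and the exact discrete chain rule for the interaction energy (this is where the midpoint enters) show that
  every time step decreases the free energy by at least \<open>\<delta>t/2\<close> times the sum of the products
  flux times jump. The free energy is bounded below, so these products tend to 0, and they control the squares
  of the fluxes. Hence along a subsequence on which \<open>\<rho> n\<close> and \<open>\<rho> (n + 1)\<close>
  converge all fluxes vanish in the limit; the two limits then agree and are a stationary solution.\<close>

section \<open>Preliminaries\<close>

text \<open>Bolzano-Weierstrass in finitely many coordinates: each new coordinate is made convergent
  by a further subsequence, which keeps the limits already found. Indexing by a finite set suits
  densities, which are functions on a finite set of cells.\<close>

lemma finite_family_convergent_subseq:
  fixes f :: "nat \<Rightarrow> 'i \<Rightarrow> real"
  assumes "finite I" and "\<And>n i. i \<in> I \<Longrightarrow> \<bar>f n i\<bar> \<le> b i"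
  shows "\<exists>r l. strict_mono r \<and> (\<forall>i\<in>I. (\<lambda>n. f (r n) i) \<longlonglongrightarrow> l i)"
  using assms
proof (induction I rule: finite_induct)
  case empty
  show ?case using strict_mono_id by blast
next
  case (insert i I)
  then obtain r l where r: "strict_mono r" and l: "\<forall>i\<in>I. (\<lambda>n. f (r n) i) \<longlonglongrightarrow> l i"
    by auto
  have "\<forall>n. f (r n) i \<in> {- b i..b i}"
    using insert.prems[of i] by (auto simp: abs_le_iff minus_le_iff)
  then obtain c s where s: "strict_mono s" and c: "((\<lambda>n. f (r n) i) \<circ> s) \<longlonglongrightarrow> c"
    using compact_Icc[of "- b i" "b i", unfolded compact_def, rule_format, of "\<lambda>n. f (r n) i"] by blast
  have "(\<lambda>n. f (r (s n)) j) \<longlonglongrightarrow> (l(i := c)) j" if "j \<in> insert i I" for j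
  proof (cases "j = i")
    case True
    then show ?thesis using c by (simp add: o_def)
  next
    case False
    then have "(\<lambda>n. f (r n) j) \<longlonglongrightarrow> l j" using l that by auto
    from LIMSEQ_subseq_LIMSEQ[OF this s] show ?thesis using False by (simp add: o_def)
  qed
  then show ?case
    using strict_mono_o[OF r s]
    by (intro exI[of _ "r \<circ> s"] exI[of _ "l(i := c)"] conjI ballI) (simp_all add: o_def)
qed

text \<open>By symmetry let \<open>y \<le> x\<close>; then \<open>ln (y / x) \<le> y / x - 1\<close>
  bounds \<open>x - y\<close> by \<open>x * (ln x - ln y)\<close>. This lets the product flux times
  jump control the square of the flux, with a weight free of logarithms.\<close>

lemma square_diff_le_ln_diff:
  fixes x y :: real
  assumes "x > 0" "y > 0"
  shows "(x - y)\<^sup>2 \<le> (x + y) * ((x - y) * (ln x - ln y))"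
proof -
  have *: "(x - y)\<^sup>2 \<le> (x + y) * ((x - y) * (ln x - ln y))" if "y > 0" "y \<le> x" for x y :: real
  proof -
    have "ln (y / x) \<le> y / x - 1" using that by (intro ln_le_minus_one) auto
    then have "x - y \<le> x * (ln x - ln y)"
      using that by (simp add: ln_div field_simps)
    also have "\<dots> \<le> (x + y) * (ln x - ln y)"
      using that by (intro mult_right_mono) auto
    finally have "(x - y) * (x - y) \<le> (x - y) * ((x + y) * (ln x - ln y))"
      using that by (intro mult_left_mono) auto
    then show ?thesis by (simp add: power2_eq_square mult_ac)
  qed
  show ?thesis
  proof (cases "y \<le> x")
    case True
    then show ?thesis using * assms by blast
  next
    case False
    then show ?thesis using *[of x y] assms
      by (simp add: power2_commute[of x] add.commute minus_mult_commute algebra_simps)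
  qed
qed

text \<open>The convex function \<open>x ln x\<close> lies above its tangent at \<open>b\<close>,
  whose slope is \<open>ln b + 1\<close>. At \<open>b = 0\<close> the tangent is meaningless because
  \<open>ln 0 = 0\<close>, so \<open>a\<close> must vanish there too.\<close>

lemma entropy_diff_le:
  fixes a b :: real
  assumes "a \<ge> 0" "b \<ge> 0" "b = 0 \<Longrightarrow> a = 0"
  shows "b * ln b - a * ln a \<le> (b - a) * ln b + (b - a)"
proof (cases "a = 0")
  case False
  then have "a > 0" "b > 0" using assms by (auto simp: less_le)
  then have "ln (b / a) \<le> b / a - 1" by (intro ln_le_minus_one) auto
  then have "a * (ln b - ln a) \<le> b - a"
    using \<open>a > 0\<close> \<open>b > 0\<close> by (simp add: ln_div field_simps)
  then show ?thesis by (simp add: algebra_simps)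
qed (use assms in auto)

lemma mult_ln_ge_minus_one:
  fixes x :: real
  assumes "x \<ge> 0"
  shows "x * ln x \<ge> - 1"
  using entropy_diff_le[of x 1] assms by simp

section \<open>The Bernoulli function\<close>

lemma bernoulli_fn_pos: "\<kappa> > 0 \<Longrightarrow> bernoulli_fn \<kappa> s > 0"
  by (auto simp: bernoulli_fn_def zero_less_divide_iff divide_less_0_iff not_less)

lemma bernoulli_fn_minus:
  assumes "\<kappa> > 0"
  shows "bernoulli_fn \<kappa> (- s) = exp (s / \<kappa>) * bernoulli_fn \<kappa> s"
proof (cases "s = 0")
  case False
  then have "exp (s / \<kappa>) - 1 \<noteq> 0" "1 - exp (s / \<kappa>) \<noteq> 0" using assms by auto
  then show ?thesis using False
    by (simp add: bernoulli_fn_def exp_minus divide_simps) (simp add: algebra_simps)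
qed (simp add: bernoulli_fn_def)

text \<open>At 0 the reciprocal is the difference quotient of \<open>exp (s / \<kappa>)\<close>,
  which tends to \<open>1 / \<kappa>\<close>; this matches the prescribed value
  \<open>\<kappa>\<close>.\<close>

lemma isCont_bernoulli_fn:
  assumes "\<kappa> > 0"
  shows "isCont (bernoulli_fn \<kappa>) s"
proof (cases "s = 0")
  case True
  have "((\<lambda>s. exp (s / \<kappa>)) has_field_derivative (1 / \<kappa>)) (at 0)"
    using assms by (auto intro!: derivative_eq_intros)
  then have "((\<lambda>s. (exp (s / \<kappa>) - 1) / s) \<longlongrightarrow> 1 / \<kappa>) (at 0)"
    by (simp add: has_field_derivative_iff)
  from tendsto_inverse[OF this] have "((\<lambda>s. s / (exp (s / \<kappa>) - 1)) \<longlongrightarrow> \<kappa>) (at 0)"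
    using assms by simp
  then have "(bernoulli_fn \<kappa> \<longlongrightarrow> \<kappa>) (at 0)"
    by (rule Lim_transform_eventually)
      (auto simp: bernoulli_fn_def eventually_at_filter)
  then show ?thesis using True by (simp add: isCont_def bernoulli_fn_def)
next
  case False
  then have "exp (s / \<kappa>) - 1 \<noteq> 0" using assms by auto
  then have "isCont (\<lambda>s. s / (exp (s / \<kappa>) - 1)) s"
    using assms by (intro continuous_intros) auto
  moreover have "\<forall>\<^sub>F s in nhds s. s / (exp (s / \<kappa>) - 1) = bernoulli_fn \<kappa> s"
    using t1_space_nhds[OF False] by eventually_elim (simp add: bernoulli_fn_def)
  ultimately show ?thesis using isCont_cong by metis
qed

text \<open>By local finiteness all other generators keep a distance \<open>e > 0\<close> from
  \<open>x\<close>, so by the triangle inequality the cell contains the ball of radius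
  \<open>e / 2\<close>. Compactness makes the volume of the cell finite, hence monotone under this
  inclusion.\<close>

lemma voronoi_cell_vol_pos:
  fixes G :: "'a::euclidean_space set"
  assumes "\<And>r. finite (G \<inter> cball 0 r)" and "compact (voronoi_cell G x)"
  shows "vol (voronoi_cell G x) > 0"
proof -
  obtain \<delta> where "\<delta> > 0"
    and \<delta>: "\<And>z. z \<in> G \<inter> cball 0 (norm x + 1) \<Longrightarrow> z \<noteq> x \<Longrightarrow> \<delta> \<le> dist x z"
    using finite_set_avoid[OF assms(1)[of "norm x + 1"], of x] by metis
  \<comment> \<open>Generators outside the ball of radius \<open>norm x + 1\<close> about 0 are
    farther than 1 from \<open>x\<close>; the minimum with 1 covers them.\<close>
  define e where "e = min \<delta> 1"
  have e: "e > 0" "e \<le> 1" "e \<le> \<delta>" using \<open>\<delta> > 0\<close> by (auto simp: e_def)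
  have far: "e \<le> dist x z" if "z \<in> G" "z \<noteq> x" for z
  proof (cases "norm z \<le> norm x + 1")
    case True
    then show ?thesis using \<delta>[of z] that e by auto
  next
    case False
    then show ?thesis using norm_triangle_sub[of z x] e by (simp add: dist_norm norm_minus_commute)
  qed
  have sub: "ball x (e / 2) \<subseteq> voronoi_cell G x"
  proof
    fix y assume y: "y \<in> ball x (e / 2)"
    have "dist y x \<le> dist y z" if "z \<in> G" for z
    proof (cases "z = x")
      case False
      then show ?thesis
        using far[OF that] y dist_triangle[of x z y] by (simp add: dist_commute)
    qed auto
    then show "y \<in> voronoi_cell G x" by (simp add: voronoi_cell_def)
  qed
  have "0 < vol (ball x (e / 2))"
    using content_ball_pos[of "e / 2" x] e by (simp add: measure_completion)
  also have "\<dots> \<le> vol (voronoi_cell G x)"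
    using sub assms(2) by (intro measure_mono_fmeasurable) (auto intro: lmeasurable_compact)
  finally show ?thesis .
qed

section \<open>One time step\<close>

text \<open>The potential of which \<open>drift\<close> is the difference quotient between two
  generators; it is the interaction part of the chemical potential.\<close>

definition midpoint_potential ::
  "('a::euclidean_space \<Rightarrow> real) \<Rightarrow> 'a set set \<Rightarrow> ('a set \<Rightarrow> 'a) \<Rightarrow>
   ('a set \<Rightarrow> real) \<Rightarrow> ('a set \<Rightarrow> real) \<Rightarrow> 'a set \<Rightarrow> real" where
  "midpoint_potential W T gen \<rho> \<rho>' K =
     (\<Sum>J\<in>T. vol J * ((\<rho>' J + \<rho> J) / 2) * W (gen K - gen J))"

locale SG_scheme =
  fixes T :: "'a::euclidean_space set set" and gen :: "'a set \<Rightarrow> 'a"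
    and W :: "'a \<Rightarrow> real" and \<kappa> \<delta>t :: real
  assumes finite_T: "finite T"
    and vol_pos: "K \<in> T \<Longrightarrow> vol K > 0"
    and inj_gen: "inj_on gen T"
    and \<kappa>_pos: "\<kappa> > 0" and \<delta>t_pos: "\<delta>t > 0"
    and W_sym: "W x = W (- x)" and W_nonneg: "W x \<ge> 0"
begin

abbreviation "V \<equiv> midpoint_potential W T gen"
abbreviation "F \<equiv> SG_flux \<kappa> W T gen"
abbreviation "N \<equiv> neighbors T"

definition SG_step :: "('a set \<Rightarrow> real) \<Rightarrow> ('a set \<Rightarrow> real) \<Rightarrow> bool" where
  "SG_step \<rho> \<rho>' \<longleftrightarrow> (\<forall>K\<in>T. vol K * ((\<rho>' K - \<rho> K) / \<delta>t) + (\<Sum>L\<in>N K. F \<rho> \<rho>' K L) = 0)"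

section \<open>Structure of the fluxes and summation by parts\<close>

lemma neighbors_sym: "K \<in> T \<Longrightarrow> L \<in> T \<Longrightarrow> L \<in> N K \<longleftrightarrow> K \<in> N L"
  by (auto simp: neighbors_def Int_commute)

lemma neighborsD: "L \<in> N K \<Longrightarrow> L \<in> T" "L \<in> N K \<Longrightarrow> L \<noteq> K"
  by (auto simp: neighbors_def)

lemma finite_neighbors: "finite (N K)"
  using finite_T by (simp add: neighbors_def)

lemma dist_gen_pos: "K \<in> T \<Longrightarrow> L \<in> N K \<Longrightarrow> dist (gen K) (gen L) > 0"
  using inj_gen neighborsD[of L K] by (auto dest: inj_onD)

lemma transmission_pos: "K \<in> T \<Longrightarrow> L \<in> N K \<Longrightarrow> transmission gen K L > 0"
  using dist_gen_pos[of K L] by (simp add: transmission_def neighbors_def)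

lemma transmission_sym: "transmission gen K L = transmission gen L K"
  by (simp add: transmission_def Int_commute dist_commute)

lemma dist_mult_drift:
  assumes "dist (gen K) (gen L) > 0"
  shows "dist (gen K) (gen L) * drift W T gen \<rho> \<rho>' K L = V \<rho> \<rho>' K - V \<rho> \<rho>' L"
  using assms unfolding drift_def midpoint_potential_def sum_distrib_left sum_subtractf[symmetric]
  by (intro sum.cong) (auto simp: field_simps)

lemma flux_potential:
  assumes "K \<in> T" "L \<in> N K"
  shows "F \<rho> \<rho>' K L = transmission gen K L *
    (bernoulli_fn \<kappa> (V \<rho> \<rho>' L - V \<rho> \<rho>' K) * \<rho>' K - bernoulli_fn \<kappa> (V \<rho> \<rho>' K - V \<rho> \<rho>' L) * \<rho>' L)"
  using dist_mult_drift[of K L] dist_mult_drift[of L K] dist_gen_pos[OF assms]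
  by (simp add: SG_flux_def dist_commute)

lemma flux_antisym: "F \<rho> \<rho>' L K = - F \<rho> \<rho>' K L"
  by (simp add: SG_flux_def transmission_sym[of L] dist_commute[of "gen L"] algebra_simps)

text \<open>\<open>bernoulli_fn_minus\<close> merges the two Bernoulli weights into one positive
  factor, so the sign of the flux is that of a difference of two weighted densities.\<close>

lemma flux_exp:
  fixes \<rho> \<rho>' :: "'a set \<Rightarrow> real"
  assumes "K \<in> T" "L \<in> N K"
  defines "s \<equiv> V \<rho> \<rho>' K - V \<rho> \<rho>' L"
  shows "F \<rho> \<rho>' K L = transmission gen K L * bernoulli_fn \<kappa> s * (exp (s / \<kappa>) * \<rho>' K - \<rho>' L)"
  using bernoulli_fn_minus[OF \<kappa>_pos, of s]
  by (simp add: flux_potential[OF assms(1,2)] s_def algebra_simps)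

text \<open>Frees the inner index set from the outer index, so that double sums over neighbors can
  be swapped.\<close>

lemma sum_neighbors: "(\<Sum>L\<in>N K. f L) = (\<Sum>L\<in>T. if L \<in> N K then f L else 0)"
  using finite_T by (simp add: sum.If_cases Int_absorb1 neighbors_def subset_iff Int_def)

text \<open>Exchange the roles of \<open>K\<close> and \<open>L\<close>: the neighbor relation is
  symmetric and the flux antisymmetric. The factor 1/2 appears because every face is counted from
  both sides.\<close>

lemma sum_by_parts:
  "(\<Sum>K\<in>T. g K * (\<Sum>L\<in>N K. F \<rho> \<rho>' K L)) = 1 / 2 * (\<Sum>K\<in>T. \<Sum>L\<in>N K. (g K - g L) * F \<rho> \<rho>' K L)"
proof -
  have "(\<Sum>K\<in>T. \<Sum>L\<in>N K. g L * F \<rho> \<rho>' K L)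
      = (\<Sum>K\<in>T. \<Sum>L\<in>T. if L \<in> N K then g L * F \<rho> \<rho>' K L else 0)"
    by (simp add: sum_neighbors)
  also have "\<dots> = (\<Sum>L\<in>T. \<Sum>K\<in>T. if L \<in> N K then g L * F \<rho> \<rho>' K L else 0)"
    by (rule sum.swap)
  also have "\<dots> = (\<Sum>L\<in>T. \<Sum>K\<in>T. if K \<in> N L then - (g L * F \<rho> \<rho>' L K) else 0)"
  proof (intro sum.cong refl)
    fix L K assume "L \<in> T" "K \<in> T"
    then show "(if L \<in> N K then g L * F \<rho> \<rho>' K L else 0)
        = (if K \<in> N L then - (g L * F \<rho> \<rho>' L K) else 0)"
      using neighbors_sym[of K L] flux_antisym[of \<rho> \<rho>' K L] by simp
  qed
  also have "\<dots> = (\<Sum>L\<in>T. \<Sum>K\<in>N L. - (g L * F \<rho> \<rho>' L K))"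
    by (simp add: sum_neighbors)
  finally show ?thesis
    by (simp add: sum_distrib_left left_diff_distrib sum_subtractf sum_negf)
qed

text \<open>The weak form of the scheme. It is used with three test functions: the indicator of
  negative cells (nonnegativity), the constant 1 (mass), and the chemical potential
  (energy).\<close>

lemma step_test_function:
  assumes "SG_step \<rho> \<rho>'"
  shows "(\<Sum>K\<in>T. g K * (vol K * (\<rho>' K - \<rho> K)))
    = - \<delta>t / 2 * (\<Sum>K\<in>T. \<Sum>L\<in>N K. (g K - g L) * F \<rho> \<rho>' K L)"
proof -
  have "vol K * (\<rho>' K - \<rho> K) = - \<delta>t * (\<Sum>L\<in>N K. F \<rho> \<rho>' K L)" if "K \<in> T" for K
    using assms that \<delta>t_pos by (simp add: SG_step_def field_simps add_eq_0_iff)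
  then have "(\<Sum>K\<in>T. g K * (vol K * (\<rho>' K - \<rho> K)))
      = (\<Sum>K\<in>T. - \<delta>t * (g K * (\<Sum>L\<in>N K. F \<rho> \<rho>' K L)))"
    by (intro sum.cong refl) (simp only: mult.left_commute)
  then show ?thesis
    using sum_by_parts[of g \<rho> \<rho>'] by (simp only: sum_distrib_left[symmetric])
qed

text \<open>The test function is the indicator of the cells with negative density: mass can only flow
  into these.\<close>

lemma step_nonneg:
  assumes "SG_step \<rho> \<rho>'" and "\<And>K. K \<in> T \<Longrightarrow> \<rho> K \<ge> 0" and "K \<in> T"
  shows "\<rho>' K \<ge> 0"
proof (rule ccontr)
  assume neg: "\<not> \<rho>' K \<ge> 0"
  define g where "g K = (if \<rho>' K < 0 then 1 else 0 :: real)" for K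
  \<comment> \<open>Where \<open>g\<close> jumps, exactly one of the two densities is negative, and
    the flux does not point out of that cell.\<close>
  have "(g K - g L) * F \<rho> \<rho>' K L \<le> 0" if "K \<in> T" "L \<in> N K" for K L
  proof -
    let ?s = "V \<rho> \<rho>' K - V \<rho> \<rho>' L"
    have c: "transmission gen K L * bernoulli_fn \<kappa> ?s \<ge> 0"
      using transmission_pos[OF that] bernoulli_fn_pos[OF \<kappa>_pos, of ?s] by simp
    consider "\<rho>' K < 0" "\<rho>' L \<ge> 0" | "\<rho>' K \<ge> 0" "\<rho>' L < 0" | "g K = g L"
      by (force simp: g_def)
    then show ?thesis
    proof cases
      case 1
      then have "exp (?s / \<kappa>) * \<rho>' K \<le> 0" by (simp add: mult_le_0_iff)
      then have "transmission gen K L * bernoulli_fn \<kappa> ?s * (exp (?s / \<kappa>) * \<rho>' K - \<rho>' L) \<le> 0"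
        using 1 c by (intro mult_nonneg_nonpos) auto
      then show ?thesis using 1 by (simp add: g_def flux_exp[OF that])
    next
      case 2
      then have "exp (?s / \<kappa>) * \<rho>' K \<ge> 0" by simp
      then have "transmission gen K L * bernoulli_fn \<kappa> ?s * (exp (?s / \<kappa>) * \<rho>' K - \<rho>' L) \<ge> 0"
        using 2 by (intro mult_nonneg_nonneg[OF c]) linarith
      then show ?thesis using 2 by (simp add: g_def flux_exp[OF that])
    qed auto
  qed
  then have "(\<Sum>K\<in>T. g K * (vol K * (\<rho>' K - \<rho> K))) \<ge> 0"
    using \<delta>t_pos unfolding step_test_function[OF assms(1)]
    by (simp add: mult_le_0_iff sum_nonpos)
  \<comment> \<open>On a cell with negative new density the increment is negative, since the old
    density is nonnegative; one such cell exists by assumption.\<close>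
  moreover have "(\<Sum>K\<in>T. g K * (vol K * (\<rho>' K - \<rho> K))) < 0"
  proof -
    have "g K * (vol K * (\<rho>' K - \<rho> K)) \<le> 0" if "K \<in> T" for K
      using vol_pos[OF that] assms(2)[OF that] by (cases "\<rho>' K < 0") (auto simp: g_def mult_le_0_iff)
    moreover have "g K * (vol K * (\<rho>' K - \<rho> K)) < 0"
      using neg vol_pos[OF assms(3)] assms(2)[OF assms(3)] by (auto simp: g_def mult_less_0_iff)
    ultimately show ?thesis
      using sum_strict_mono_ex1[OF finite_T, of "\<lambda>K. g K * (vol K * (\<rho>' K - \<rho> K))" "\<lambda>_. 0"] assms(3)
      by auto
  qed
  ultimately show False by simp
qed

lemma step_discrete_prob:
  assumes "SG_step \<rho> \<rho>'" and "\<rho> \<in> discrete_prob T"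
  shows "\<rho>' \<in> discrete_prob T"
proof -
  \<comment> \<open>The constant test function has no jumps, so the total mass is conserved.\<close>
  have "(\<Sum>K\<in>T. vol K * \<rho>' K) = (\<Sum>K\<in>T. vol K * \<rho> K)"
    using step_test_function[OF assms(1), of "\<lambda>_. 1"] by (simp add: right_diff_distrib sum_subtractf)
  then show ?thesis
    using assms step_nonneg[OF assms(1)] by (auto simp: discrete_prob_def)
qed

text \<open>Since \<open>ln 0 = 0\<close>, the chemical potential is meaningless on cells without mass; such cells do not
  interact with the others.\<close>

lemma step_vacuum:
  assumes "SG_step \<rho> \<rho>'" and "\<rho> \<in> discrete_prob T" and "K \<in> T" "\<rho>' K = 0"
  shows "\<rho> K = 0" and "L \<in> N K \<Longrightarrow> \<rho>' L = 0"
proof -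
  have in_nonneg: "- F \<rho> \<rho>' K L \<ge> 0" if "L \<in> N K" for L
  proof -
    have "\<rho>' L \<ge> 0"
      using step_discrete_prob[OF assms(1,2)] neighborsD[OF that] by (auto simp: discrete_prob_def)
    then show ?thesis
      using transmission_pos[OF assms(3) that] assms(4)
        bernoulli_fn_pos[OF \<kappa>_pos, of "V \<rho> \<rho>' K - V \<rho> \<rho>' L"]
      by (simp add: flux_exp[OF assms(3) that])
  qed
  \<comment> \<open>With \<open>\<rho>' K = 0\<close> the scheme at \<open>K\<close> says that old
    mass plus total inflow is 0. Both are nonnegative, so both vanish, and so does every single
    inflow.\<close>
  have eq: "vol K * (\<rho> K / \<delta>t) + (\<Sum>L\<in>N K. - F \<rho> \<rho>' K L) = 0"
    using assms(1,3,4) by (auto simp: SG_step_def sum_negf)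
  have "vol K * (\<rho> K / \<delta>t) \<ge> 0"
    using assms(2,3) vol_pos[of K] \<delta>t_pos by (auto simp: discrete_prob_def)
  moreover have "(\<Sum>L\<in>N K. - F \<rho> \<rho>' K L) \<ge> 0"
    using in_nonneg by (intro sum_nonneg)
  ultimately have *: "vol K * (\<rho> K / \<delta>t) = 0" "(\<Sum>L\<in>N K. - F \<rho> \<rho>' K L) = 0"
    using eq by linarith+
  show "\<rho> K = 0" using *(1) vol_pos[OF assms(3)] \<delta>t_pos by auto
  assume L: "L \<in> N K"
  have "- F \<rho> \<rho>' K L = 0"
    using *(2) sum_nonneg_eq_0_iff[OF finite_neighbors, of K "\<lambda>L. - F \<rho> \<rho>' K L"] in_nonneg L by blast
  then show "\<rho>' L = 0"
    using transmission_pos[OF assms(3) L] assms(4)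
      bernoulli_fn_pos[OF \<kappa>_pos, of "V \<rho> \<rho>' K - V \<rho> \<rho>' L"]
    by (simp add: flux_exp[OF assms(3) L])
qed

section \<open>Energy dissipation\<close>

definition dissipation :: "('a set \<Rightarrow> real) \<Rightarrow> ('a set \<Rightarrow> real) \<Rightarrow> 'a set \<Rightarrow> 'a set \<Rightarrow> real" where
  "dissipation \<rho> \<rho>' K L =
    ((\<kappa> * ln (\<rho>' K) + V \<rho> \<rho>' K) - (\<kappa> * ln (\<rho>' L) + V \<rho> \<rho>' L)) * F \<rho> \<rho>' K L"

text \<open>With the \<open>x\<close>, \<open>y\<close>, \<open>c\<close> below, the flux is
  \<open>c * (x - y)\<close> and the dissipation
  \<open>c * \<kappa> * ((x - y) * (ln x - ln y))\<close>, so \<open>square_diff_le_ln_diff\<close>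
  applies. The prefactor \<open>c * (x + y) / \<kappa>\<close> is stated through Bernoulli weights,
  a form continuous in the densities even at vacuum, where the logarithms are not.\<close>

lemma flux_square_le_dissipation:
  assumes "SG_step \<rho> \<rho>'" and "\<rho> \<in> discrete_prob T" and "K \<in> T" "L \<in> N K"
  shows "(F \<rho> \<rho>' K L)\<^sup>2 \<le> transmission gen K L *
    (bernoulli_fn \<kappa> (V \<rho> \<rho>' L - V \<rho> \<rho>' K) * \<rho>' K + bernoulli_fn \<kappa> (V \<rho> \<rho>' K - V \<rho> \<rho>' L) * \<rho>' L) / \<kappa>
      * dissipation \<rho> \<rho>' K L"
    and "dissipation \<rho> \<rho>' K L \<ge> 0"
proof -
  define s where "s = V \<rho> \<rho>' K - V \<rho> \<rho>' L"
  define c where "c = transmission gen K L * bernoulli_fn \<kappa> s"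
  define x where "x = exp (s / \<kappa>) * \<rho>' K"
  define y where "y = \<rho>' L"
  have LT: "L \<in> T" "K \<in> N L" using assms(3,4) neighborsD(1) neighbors_sym by blast+
  have nn: "\<rho>' K \<ge> 0" "\<rho>' L \<ge> 0"
    using step_discrete_prob[OF assms(1,2)] assms(3) LT by (auto simp: discrete_prob_def)
  have "c > 0"
    using transmission_pos[OF assms(3,4)] bernoulli_fn_pos[OF \<kappa>_pos, of s] by (simp add: c_def)
  have F: "F \<rho> \<rho>' K L = c * (x - y)"
    using flux_exp[OF assms(3,4)] by (simp add: c_def x_def y_def s_def)
  have coeff: "transmission gen K L * (bernoulli_fn \<kappa> (V \<rho> \<rho>' L - V \<rho> \<rho>' K) * \<rho>' K
      + bernoulli_fn \<kappa> (V \<rho> \<rho>' K - V \<rho> \<rho>' L) * \<rho>' L) = c * (x + y)"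
    using bernoulli_fn_minus[OF \<kappa>_pos, of s] by (simp add: c_def x_def y_def s_def algebra_simps)
  have *: "(F \<rho> \<rho>' K L)\<^sup>2 \<le> c * (x + y) / \<kappa> * dissipation \<rho> \<rho>' K L \<and> dissipation \<rho> \<rho>' K L \<ge> 0"
  \<comment> \<open>If one cell is empty, \<open>step_vacuum\<close> empties the other; the flux is
    then 0 and the value \<open>ln 0 = 0\<close> does no harm.\<close>
  proof (cases "\<rho>' K = 0 \<or> \<rho>' L = 0")
    case True
    then have "\<rho>' K = 0" "\<rho>' L = 0"
      using step_vacuum(2)[OF assms(1,2,3) _ assms(4)] step_vacuum(2)[OF assms(1,2) LT(1) _ LT(2)]
      by blast+
    then have "F \<rho> \<rho>' K L = 0" by (simp add: F x_def y_def)
    then show ?thesis by (simp add: dissipation_def)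
  next
    case False
    then have pos: "\<rho>' K > 0" "y > 0" "x > 0" using nn by (auto simp: x_def y_def)
    have "ln x = s / \<kappa> + ln (\<rho>' K)" using pos by (simp add: x_def ln_mult)
    then have "\<kappa> * ln x = s + \<kappa> * ln (\<rho>' K)"
      using \<kappa>_pos by (simp add: distrib_left)
    then have "(\<kappa> * ln (\<rho>' K) + V \<rho> \<rho>' K) - (\<kappa> * ln (\<rho>' L) + V \<rho> \<rho>' L) = \<kappa> * (ln x - ln y)"
      by (simp add: right_diff_distrib s_def y_def)
    then have D: "dissipation \<rho> \<rho>' K L = c * \<kappa> * ((x - y) * (ln x - ln y))"
      by (simp add: dissipation_def F)
    have "(x - y) * (ln x - ln y) \<ge> 0"
      using pos by (cases "x \<ge> y") (auto intro: mult_nonpos_nonpos)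
    then have "dissipation \<rho> \<rho>' K L \<ge> 0" using \<open>c > 0\<close> \<kappa>_pos by (simp add: D)
    moreover have "(F \<rho> \<rho>' K L)\<^sup>2 = c\<^sup>2 * (x - y)\<^sup>2" by (simp add: F power_mult_distrib)
    moreover have "c\<^sup>2 * (x - y)\<^sup>2 \<le> c\<^sup>2 * ((x + y) * ((x - y) * (ln x - ln y)))"
      using square_diff_le_ln_diff[OF pos(3,2)] by (intro mult_left_mono) auto
    moreover have "c\<^sup>2 * ((x + y) * ((x - y) * (ln x - ln y)))
        = c * (x + y) / \<kappa> * dissipation \<rho> \<rho>' K L"
      using \<kappa>_pos by (simp add: D power2_eq_square)
    ultimately show ?thesis by simp
  qed
  then show "(F \<rho> \<rho>' K L)\<^sup>2 \<le> transmission gen K L *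
    (bernoulli_fn \<kappa> (V \<rho> \<rho>' L - V \<rho> \<rho>' K) * \<rho>' K + bernoulli_fn \<kappa> (V \<rho> \<rho>' K - V \<rho> \<rho>' L) * \<rho>' L) / \<kappa>
      * dissipation \<rho> \<rho>' K L"
    unfolding coeff by blast
  show "dissipation \<rho> \<rho>' K L \<ge> 0" using * by blast
qed

text \<open>For a symmetric bilinear form, \<open>w(\<rho>', \<rho>') - w(\<rho>, \<rho>) =
  w(\<rho>' - \<rho>, \<rho>' + \<rho>)\<close>; the mixed terms cancel because \<open>W\<close> is
  even. The sum \<open>\<rho>' + \<rho>\<close> is twice the midpoint density.\<close>

lemma interaction_energy_diff:
  "1 / 2 * (\<Sum>K\<in>T. \<Sum>L\<in>T. vol K * vol L * W (gen K - gen L) * \<rho>' K * \<rho>' L)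
   - 1 / 2 * (\<Sum>K\<in>T. \<Sum>L\<in>T. vol K * vol L * W (gen K - gen L) * \<rho> K * \<rho> L)
   = (\<Sum>K\<in>T. vol K * (\<rho>' K - \<rho> K) * V \<rho> \<rho>' K)"
proof -
  define w where "w K L = vol K * vol L * W (gen K - gen L)" for K L
  have w_sym: "w K L = w L K" for K L
    using W_sym[of "gen K - gen L"] by (simp add: w_def)
  have "(\<Sum>K\<in>T. \<Sum>L\<in>T. w K L * (\<rho> K * \<rho>' L)) = (\<Sum>K\<in>T. \<Sum>L\<in>T. w K L * (\<rho>' K * \<rho> L))"
    by (subst sum.swap) (intro sum.cong refl, simp add: w_sym mult_ac)
  then have "1 / 2 * (\<Sum>K\<in>T. \<Sum>L\<in>T. w K L * (\<rho>' K * \<rho>' L))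
      - 1 / 2 * (\<Sum>K\<in>T. \<Sum>L\<in>T. w K L * (\<rho> K * \<rho> L))
    = 1 / 2 * (\<Sum>K\<in>T. \<Sum>L\<in>T. w K L * ((\<rho>' K - \<rho> K) * (\<rho>' L + \<rho> L)))"
    by (simp add: algebra_simps sum.distrib sum_subtractf)
  also have "\<dots> = (\<Sum>K\<in>T. vol K * (\<rho>' K - \<rho> K) * V \<rho> \<rho>' K)"
    unfolding midpoint_potential_def sum_distrib_left w_def
    by (intro sum.cong refl) (simp add: field_simps)
  finally show ?thesis by (simp add: w_def mult.assoc)
qed

text \<open>The energy increment is at most the pairing of the chemical potential with
  \<open>\<rho>' - \<rho>\<close>, which the weak form rewrites as a sum over faces.\<close>

lemma energy_dissipation:
  assumes "SG_step \<rho> \<rho>'" and "\<rho> \<in> discrete_prob T"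
  shows "\<delta>t / 2 * (\<Sum>K\<in>T. \<Sum>L\<in>N K. dissipation \<rho> \<rho>' K L)
    \<le> free_energy \<kappa> W T gen \<rho> - free_energy \<kappa> W T gen \<rho>'"
proof -
  have \<rho>': "\<rho>' \<in> discrete_prob T" by (rule step_discrete_prob[OF assms])
  have "(\<Sum>K\<in>T. vol K * \<rho>' K * ln (\<rho>' K)) - (\<Sum>K\<in>T. vol K * \<rho> K * ln (\<rho> K))
      = (\<Sum>K\<in>T. vol K * (\<rho>' K * ln (\<rho>' K) - \<rho> K * ln (\<rho> K)))"
    by (simp add: right_diff_distrib sum_subtractf mult.assoc)
  also have "\<dots> \<le> (\<Sum>K\<in>T. vol K * ((\<rho>' K - \<rho> K) * ln (\<rho>' K) + (\<rho>' K - \<rho> K)))"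
  proof (intro sum_mono mult_left_mono)
    fix K assume K: "K \<in> T"
    show "\<rho>' K * ln (\<rho>' K) - \<rho> K * ln (\<rho> K) \<le> (\<rho>' K - \<rho> K) * ln (\<rho>' K) + (\<rho>' K - \<rho> K)"
      using K assms(2) \<rho>' step_vacuum(1)[OF assms K]
      by (intro entropy_diff_le) (auto simp: discrete_prob_def)
    show "vol K \<ge> 0" by simp
  qed
  \<comment> \<open>The constant part of the slope of the tangent contributes the difference of the
    total masses, which is 0.\<close>
  also have "\<dots> = (\<Sum>K\<in>T. vol K * (\<rho>' K - \<rho> K) * ln (\<rho>' K))"
    using assms(2) \<rho>'
    by (simp add: discrete_prob_def distrib_left right_diff_distrib left_diff_distrib
        sum.distrib sum_subtractf mult.assoc)
  finally have entropy: "\<kappa> * ((\<Sum>K\<in>T. vol K * \<rho>' K * ln (\<rho>' K)) - (\<Sum>K\<in>T. vol K * \<rho> K * ln (\<rho> K)))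
      \<le> \<kappa> * (\<Sum>K\<in>T. vol K * (\<rho>' K - \<rho> K) * ln (\<rho>' K))"
    using \<kappa>_pos by (intro mult_left_mono) auto
  have "free_energy \<kappa> W T gen \<rho>' - free_energy \<kappa> W T gen \<rho>
      \<le> \<kappa> * (\<Sum>K\<in>T. vol K * (\<rho>' K - \<rho> K) * ln (\<rho>' K)) + (\<Sum>K\<in>T. vol K * (\<rho>' K - \<rho> K) * V \<rho> \<rho>' K)"
    using entropy interaction_energy_diff[of \<rho>' \<rho>]
    unfolding free_energy_def right_diff_distrib by linarith
  also have "\<dots> = (\<Sum>K\<in>T. (\<kappa> * ln (\<rho>' K) + V \<rho> \<rho>' K) * (vol K * (\<rho>' K - \<rho> K)))"
    by (simp add: sum_distrib_left sum.distrib[symmetric] algebra_simps)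
  also have "\<dots> = - \<delta>t / 2 * (\<Sum>K\<in>T. \<Sum>L\<in>N K. dissipation \<rho> \<rho>' K L)"
    unfolding step_test_function[OF assms(1)] dissipation_def ..
  finally show ?thesis by simp
qed

text \<open>The entropy density is at least -1 on every cell, and the interaction part is
  nonnegative because \<open>W\<close> is.\<close>

lemma free_energy_ge:
  assumes "\<rho> \<in> discrete_prob T"
  shows "free_energy \<kappa> W T gen \<rho> \<ge> - \<kappa> * (\<Sum>K\<in>T. vol K)"
proof -
  have nn: "\<rho> K \<ge> 0" if "K \<in> T" for K using assms that by (auto simp: discrete_prob_def)
  have "(\<Sum>K\<in>T. vol K * (- 1)) \<le> (\<Sum>K\<in>T. vol K * (\<rho> K * ln (\<rho> K)))"
    using nn mult_ln_ge_minus_one by (intro sum_mono mult_left_mono) auto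
  then have "- (\<Sum>K\<in>T. vol K) \<le> (\<Sum>K\<in>T. vol K * \<rho> K * ln (\<rho> K))"
    by (simp add: sum_negf mult.assoc)
  then have "\<kappa> * - (\<Sum>K\<in>T. vol K) \<le> \<kappa> * (\<Sum>K\<in>T. vol K * \<rho> K * ln (\<rho> K))"
    using \<kappa>_pos by (intro mult_left_mono) auto
  moreover have "(\<Sum>K\<in>T. \<Sum>L\<in>T. vol K * vol L * W (gen K - gen L) * \<rho> K * \<rho> L) \<ge> 0"
    using nn W_nonneg by (intro sum_nonneg mult_nonneg_nonneg) auto
  ultimately show ?thesis unfolding free_energy_def by simp
qed

section \<open>Large time limit\<close>

text \<open>No cell carries more than the total mass 1. This supplies the bounds for extracting
  convergent subsequences.\<close>

lemma discrete_prob_le: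
  assumes "\<rho> \<in> discrete_prob T" "K \<in> T"
  shows "\<bar>\<rho> K\<bar> \<le> 1 / vol K"
proof -
  have "vol K * \<rho> K \<le> (\<Sum>K\<in>T. vol K * \<rho> K)"
    using assms finite_T by (intro member_le_sum) (auto simp: discrete_prob_def)
  then show ?thesis
    using assms vol_pos[OF assms(2)] by (auto simp: discrete_prob_def field_simps)
qed

section \<open>Continuity of the scheme in the densities\<close>

lemma tendsto_bernoulli_fn [tendsto_intros]:
  "(f \<longlongrightarrow> l) A \<Longrightarrow> ((\<lambda>x. bernoulli_fn \<kappa> (f x)) \<longlongrightarrow> bernoulli_fn \<kappa> l) A"
  using isCont_tendsto_compose[OF isCont_bernoulli_fn[OF \<kappa>_pos]] by blast

lemma tendsto_midpoint_potential [tendsto_intros]: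
  assumes "\<And>J. J \<in> T \<Longrightarrow> ((\<lambda>x. f x J) \<longlongrightarrow> \<rho> J) A" "\<And>J. J \<in> T \<Longrightarrow> ((\<lambda>x. g x J) \<longlongrightarrow> \<rho>' J) A"
  shows "((\<lambda>x. V (f x) (g x) K) \<longlongrightarrow> V \<rho> \<rho>' K) A"
  unfolding midpoint_potential_def using assms by (auto intro!: tendsto_intros)

lemma tendsto_flux:
  assumes "\<And>J. J \<in> T \<Longrightarrow> ((\<lambda>x. f x J) \<longlongrightarrow> \<rho> J) A" "\<And>J. J \<in> T \<Longrightarrow> ((\<lambda>x. g x J) \<longlongrightarrow> \<rho>' J) A"
    and "K \<in> T" "L \<in> N K"
  shows "((\<lambda>x. F (f x) (g x) K L) \<longlongrightarrow> F \<rho> \<rho>' K L) A"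
  unfolding flux_potential[OF assms(3,4)]
  using assms neighborsD(1)[OF assms(4)] by (intro tendsto_intros) auto

text \<open>Limits of densities are known on the cells of \<open>T\<close> only, so equality of
  functions is not at hand.\<close>

lemma flux_cong:
  assumes "\<And>J. J \<in> T \<Longrightarrow> \<rho> J = \<sigma> J" "\<And>J. J \<in> T \<Longrightarrow> \<rho>' J = \<sigma>' J" and "K \<in> T" "L \<in> N K"
  shows "F \<rho> \<rho>' K L = F \<sigma> \<sigma>' K L"
proof -
  have "V \<rho> \<rho>' J = V \<sigma> \<sigma>' J" for J
    unfolding midpoint_potential_def using assms(1,2) by (intro sum.cong) auto
  then show ?thesis
    using assms neighborsD(1)[OF assms(4)] by (simp add: flux_potential)
qed

lemma SG_solution_iff_step:
  "SG_solution \<kappa> \<delta>t W T gen \<rho> \<longleftrightarrow> (\<forall>n. SG_step (\<rho> n) (\<rho> (Suc n)))"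
  by (simp add: SG_solution_def SG_step_def)

context
  fixes \<rho> :: "nat \<Rightarrow> 'a set \<Rightarrow> real"
  assumes sol: "SG_solution \<kappa> \<delta>t W T gen \<rho>" and init: "\<rho> 0 \<in> discrete_prob T"
begin

lemma solution_step: "SG_step (\<rho> n) (\<rho> (Suc n))"
  using sol by (simp add: SG_solution_iff_step)

lemma solution_discrete_prob: "\<rho> n \<in> discrete_prob T"
  by (induction n) (auto intro: init step_discrete_prob solution_step)

text \<open>The energies decrease and are bounded below, hence converge, so their decrements tend to
  0. Since all dissipations are nonnegative, each one lies between 0 and
  \<open>2 / \<delta>t\<close> times the decrement.\<close>

lemma dissipation_tendsto_0:
  assumes "K \<in> T" "L \<in> N K"
  shows "(\<lambda>n. dissipation (\<rho> n) (\<rho> (Suc n)) K L) \<longlonglongrightarrow> 0"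
proof -
  define E where "E n = free_energy \<kappa> W T gen (\<rho> n)" for n
  have nonneg: "dissipation (\<rho> n) (\<rho> (Suc n)) K L \<ge> 0" if "K \<in> T" "L \<in> N K" for n K L
    using flux_square_le_dissipation(2)[OF solution_step solution_discrete_prob that] .
  have le: "\<delta>t / 2 * dissipation (\<rho> n) (\<rho> (Suc n)) K L \<le> E n - E (Suc n)" for n
  proof -
    have "dissipation (\<rho> n) (\<rho> (Suc n)) K L \<le> (\<Sum>L\<in>N K. dissipation (\<rho> n) (\<rho> (Suc n)) K L)"
      using assms nonneg finite_neighbors by (intro member_le_sum) auto
    also have "\<dots> \<le> (\<Sum>K\<in>T. \<Sum>L\<in>N K. dissipation (\<rho> n) (\<rho> (Suc n)) K L)"
      using assms nonneg finite_T
      by (intro member_le_sum[of _ _ "\<lambda>K. \<Sum>L\<in>N K. dissipation (\<rho> n) (\<rho> (Suc n)) K L"])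
        (auto intro: sum_nonneg)
    finally have "\<delta>t / 2 * dissipation (\<rho> n) (\<rho> (Suc n)) K L
        \<le> \<delta>t / 2 * (\<Sum>K\<in>T. \<Sum>L\<in>N K. dissipation (\<rho> n) (\<rho> (Suc n)) K L)"
      using \<delta>t_pos by (intro mult_left_mono) auto
    also have "\<dots> \<le> E n - E (Suc n)"
      unfolding E_def by (rule energy_dissipation[OF solution_step solution_discrete_prob])
    finally show ?thesis .
  qed
  have "E (Suc n) \<le> E n" for n
    using le[of n] mult_nonneg_nonneg[OF _ nonneg[OF assms], of "\<delta>t / 2" n] \<delta>t_pos by simp
  then have "decseq E" by (rule decseq_SucI)
  moreover have "- \<kappa> * (\<Sum>K\<in>T. vol K) \<le> E n" for n
    unfolding E_def by (rule free_energy_ge[OF solution_discrete_prob])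
  ultimately obtain e where e: "E \<longlonglongrightarrow> e"
    using decseq_convergent[of E "- \<kappa> * (\<Sum>K\<in>T. vol K)"] by metis
  have "(\<lambda>n. 2 / \<delta>t * (E n - E (Suc n))) \<longlonglongrightarrow> 2 / \<delta>t * (e - e)"
    by (rule tendsto_mult_left[OF tendsto_diff[OF e LIMSEQ_Suc[OF e]]])
  then have upper: "(\<lambda>n. 2 / \<delta>t * (E n - E (Suc n))) \<longlonglongrightarrow> 0" by simp
  have "dissipation (\<rho> n) (\<rho> (Suc n)) K L \<le> 2 / \<delta>t * (E n - E (Suc n))" for n
    using le[of n] \<delta>t_pos by (simp add: field_simps)
  then show ?thesis
    using nonneg[OF assms] by (intro tendsto_sandwich[OF _ _ tendsto_const upper] always_eventually allI)
qed

text \<open>Two limits are allowed, as consecutive iterates are not yet known to approach each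
  other. First the fluxes of the pair \<open>\<sigma>\<close>, \<open>\<sigma>'\<close> vanish, then
  the limit of the scheme forces \<open>\<sigma>' = \<sigma>\<close> on \<open>T\<close>.\<close>

lemma limit_stationary:
  assumes r: "strict_mono r"
    and lim: "\<And>K. K \<in> T \<Longrightarrow> (\<lambda>n. \<rho> (r n) K) \<longlonglongrightarrow> \<sigma> K"
    and lim': "\<And>K. K \<in> T \<Longrightarrow> (\<lambda>n. \<rho> (Suc (r n)) K) \<longlonglongrightarrow> \<sigma>' K"
  shows "\<sigma> \<in> stationary_solutions \<kappa> \<delta>t W T gen"
proof -
  have flux0: "F \<sigma> \<sigma>' K L = 0" if KL: "K \<in> T" "L \<in> N K" for K L
  proof -
    \<comment> \<open>The prefactor from \<open>flux_square_le_dissipation\<close>; it converges, so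
      its product with the vanishing dissipation tends to 0.\<close>
    let ?c = "\<lambda>\<rho> \<rho>'. transmission gen K L * (bernoulli_fn \<kappa> (V \<rho> \<rho>' L - V \<rho> \<rho>' K) * \<rho>' K
      + bernoulli_fn \<kappa> (V \<rho> \<rho>' K - V \<rho> \<rho>' L) * \<rho>' L) / \<kappa>"
    let ?D = "\<lambda>n. dissipation (\<rho> n) (\<rho> (Suc n)) K L"
    have "(\<lambda>n. ?D (r n)) \<longlonglongrightarrow> 0"
      using LIMSEQ_subseq_LIMSEQ[OF dissipation_tendsto_0[OF KL] r] by (simp add: o_def)
    moreover have "(\<lambda>n. ?c (\<rho> (r n)) (\<rho> (Suc (r n)))) \<longlonglongrightarrow> ?c \<sigma> \<sigma>'"
      using KL neighborsD(1)[OF KL(2)] \<kappa>_pos by (intro tendsto_intros lim lim') auto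
    ultimately have "(\<lambda>n. ?c (\<rho> (r n)) (\<rho> (Suc (r n))) * ?D (r n)) \<longlonglongrightarrow> ?c \<sigma> \<sigma>' * 0"
      by (rule tendsto_mult[rotated])
    moreover have "(\<lambda>n. (F (\<rho> (r n)) (\<rho> (Suc (r n))) K L)\<^sup>2) \<longlonglongrightarrow> (F \<sigma> \<sigma>' K L)\<^sup>2"
      by (intro tendsto_power tendsto_flux lim lim' KL)
    moreover have "(F (\<rho> (r n)) (\<rho> (Suc (r n))) K L)\<^sup>2 \<le> ?c (\<rho> (r n)) (\<rho> (Suc (r n))) * ?D (r n)" for n
      by (rule flux_square_le_dissipation(1)[OF solution_step solution_discrete_prob KL])
    ultimately have "(F \<sigma> \<sigma>' K L)\<^sup>2 \<le> ?c \<sigma> \<sigma>' * 0"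
      by (meson LIMSEQ_le)
    then show ?thesis by simp
  qed
  have eq: "\<sigma>' K = \<sigma> K" if K: "K \<in> T" for K
  proof -
    have "(\<lambda>n. vol K * ((\<rho> (Suc (r n)) K - \<rho> (r n) K) / \<delta>t)
        + (\<Sum>L\<in>N K. F (\<rho> (r n)) (\<rho> (Suc (r n))) K L))
      \<longlonglongrightarrow> vol K * ((\<sigma>' K - \<sigma> K) / \<delta>t) + (\<Sum>L\<in>N K. F \<sigma> \<sigma>' K L)"
      using K \<delta>t_pos by (intro tendsto_intros lim lim' tendsto_flux) auto
    moreover have "vol K * ((\<rho> (Suc (r n)) K - \<rho> (r n) K) / \<delta>t)
        + (\<Sum>L\<in>N K. F (\<rho> (r n)) (\<rho> (Suc (r n))) K L) = 0" for n
      using solution_step K by (simp add: SG_step_def)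
    ultimately have "vol K * ((\<sigma>' K - \<sigma> K) / \<delta>t) + (\<Sum>L\<in>N K. F \<sigma> \<sigma>' K L) = 0"
      by (simp add: LIMSEQ_const_iff)
    then show ?thesis using vol_pos[OF K] \<delta>t_pos flux0[OF K] by simp
  qed
  have "F \<sigma> \<sigma> K L = F \<sigma> \<sigma>' K L" if "K \<in> T" "L \<in> N K" for K L
    using that eq by (intro flux_cong) auto
  then have "F \<sigma> \<sigma> K L = 0" if "K \<in> T" "L \<in> N K" for K L
    using flux0 that by simp
  then have "SG_solution \<kappa> \<delta>t W T gen (\<lambda>n. \<sigma>)"
    by (simp add: SG_solution_iff_step SG_step_def)
  moreover have "\<sigma> \<in> discrete_prob T"
  proof -
    have "\<sigma> K \<ge> 0" if "K \<in> T" for K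
      using solution_discrete_prob that
      by (intro LIMSEQ_le_const[OF lim[OF that]]) (auto simp: discrete_prob_def)
    moreover have "(\<lambda>n. \<Sum>K\<in>T. vol K * \<rho> (r n) K) \<longlonglongrightarrow> (\<Sum>K\<in>T. vol K * \<sigma> K)"
      by (intro tendsto_intros lim)
    then have "(\<Sum>K\<in>T. vol K * \<sigma> K) = 1"
      using solution_discrete_prob by (simp add: discrete_prob_def LIMSEQ_const_iff)
    ultimately show ?thesis by (simp add: discrete_prob_def)
  qed
  ultimately show ?thesis by (simp add: stationary_solutions_def)
qed

text \<open>By compactness: iterates that stay at distance at least \<open>e\<close> from the
  stationary set would have a subsequence converging to a stationary solution.\<close>

lemma setdist_stationary_tendsto_0:
  "(\<lambda>n. l1_setdist T (\<rho> n) (stationary_solutions \<kappa> \<delta>t W T gen)) \<longlonglongrightarrow> 0"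
proof (rule ccontr)
  let ?S = "stationary_solutions \<kappa> \<delta>t W T gen"
  assume "\<not> ?thesis"
  then obtain e where "e > 0"
    and "\<not> (\<forall>\<^sub>F n in sequentially. l1_setdist T (\<rho> n) ?S < e)"
    unfolding order_tendsto_iff by auto
  then have "infinite {n. e \<le> l1_setdist T (\<rho> n) ?S}"
    by (simp add: not_eventually not_less frequently_sequentially infinite_nat_iff_unbounded_le)
  then obtain q :: "nat \<Rightarrow> nat" where q: "strict_mono q" "\<And>n. e \<le> l1_setdist T (\<rho> (q n)) ?S"
    using infinite_enumerate by blast
  \<comment> \<open>An index pairs a shift 0 or 1 with a cell, so one extraction makes the current
    and the next iterate converge along the same subsequence.\<close>
  have "\<bar>\<rho> (q n + fst i) (snd i)\<bar> \<le> 1 / vol (snd i)" if "i \<in> {0, 1} \<times> T" for n i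
    using that by (intro discrete_prob_le[OF solution_discrete_prob]) auto
  then obtain p l where p: "strict_mono p"
    and l: "\<forall>i\<in>{0, 1} \<times> T. (\<lambda>n. \<rho> (q (p n) + fst i) (snd i)) \<longlonglongrightarrow> l i"
    using finite_family_convergent_subseq[of "{0, 1} \<times> T" "\<lambda>n i. \<rho> (q n + fst i) (snd i)"
        "\<lambda>i. 1 / vol (snd i)"] finite_T by blast
  define \<sigma> where "\<sigma> K = l (0, K)" for K
  have lim: "(\<lambda>n. \<rho> (q (p n)) K) \<longlonglongrightarrow> \<sigma> K" if "K \<in> T" for K
    using bspec[OF l, of "(0, K)"] that by (simp add: \<sigma>_def)
  have "(\<lambda>n. \<rho> (Suc (q (p n))) K) \<longlonglongrightarrow> l (1, K)" if "K \<in> T" for K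
    using bspec[OF l, of "(1, K)"] that by simp
  then have \<sigma>: "\<sigma> \<in> ?S"
    by (intro limit_stationary[of "q \<circ> p" \<sigma> "\<lambda>K. l (1, K)"] strict_mono_o[OF q(1) p])
      (simp_all add: lim)
  have "(\<lambda>n. l1_norm T (\<lambda>K. \<rho> (q (p n)) K - \<sigma> K)) \<longlonglongrightarrow> (\<Sum>K\<in>T. vol K * \<bar>\<sigma> K - \<sigma> K\<bar>)"
    unfolding l1_norm_def by (intro tendsto_intros lim)
  then have "(\<lambda>n. l1_norm T (\<lambda>K. \<rho> (q (p n)) K - \<sigma> K)) \<longlonglongrightarrow> 0" by simp
  from tendsto_ennrealI[OF this]
  have lim_norm: "(\<lambda>n. ennreal (l1_norm T (\<lambda>K. \<rho> (q (p n)) K - \<sigma> K))) \<longlonglongrightarrow> ennreal 0" .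
  \<comment> \<open>The limit \<open>\<sigma>\<close> is a competitor in the infimum that defines
    the distance.\<close>
  have "e \<le> ennreal (l1_norm T (\<lambda>K. \<rho> (q (p n)) K - \<sigma> K))" for n
    using q(2)[of "p n"] INF_lower[OF \<sigma>, of "\<lambda>\<sigma>. ennreal (l1_norm T (\<lambda>K. \<rho> (q (p n)) K - \<sigma> K))"]
    unfolding l1_setdist_def by (rule order_trans)
  then have "e \<le> ennreal 0" by (intro LIMSEQ_le_const[OF lim_norm]) blast
  then show False using \<open>e > 0\<close> by simp
qed

end

end

section \<open>Application to Voronoi meshes\<close>

lemma SG_scheme_voronoi_mesh:
  fixes W :: "'a::euclidean_space \<Rightarrow> real"
  assumes "voronoi_mesh \<Omega> h T gen" "\<kappa> > 0" "\<delta>t > 0" "\<And>x. W x = W (- x)" "\<And>x. W x \<ge> 0"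
  shows "SG_scheme T gen W \<kappa> \<delta>t"
proof -
  note mesh = assms(1)[unfolded voronoi_mesh_def]
  obtain G where "(\<forall>r. finite (G \<inter> cball 0 r)) \<and> (\<forall>K\<in>T. gen K \<in> G \<and> K = voronoi_cell G (gen K))"
    using mesh[THEN conjunct2, THEN conjunct1] by (rule exE)
  then have G: "finite (G \<inter> cball 0 r)" "K \<in> T \<Longrightarrow> voronoi_cell G (gen K) = K" for r K
    by (rule conjunct1[THEN spec], elim conjE) (drule (1) bspec, elim conjE, erule sym)
  have T: "finite T" "\<And>K. K \<in> T \<Longrightarrow> compact K"
    using mesh by simp_all
  show ?thesis
  proof (rule SG_scheme.intro)
    show "vol K > 0" if "K \<in> T" for K
      using voronoi_cell_vol_pos[OF G(1), of "gen K"] G(2)[OF that] T(2)[OF that] by simp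
    \<comment> \<open>A cell is recovered from its generator, so \<open>voronoi_cell G\<close> is a
      left inverse of \<open>gen\<close> on \<open>T\<close>.\<close>
    show "inj_on gen T" by (rule inj_on_inverseI[where g = "voronoi_cell G"]) (rule G(2))
    show "finite T" by (rule T(1))
    show "\<kappa> > 0" "\<delta>t > 0" "W x = W (- x)" "W x \<ge> 0" for x
      by (rule assms)+
  qed
qed

theorem theorem3:
  fixes \<Omega> :: "'a::euclidean_space set"
    and T :: "'a set set"
    and gen :: "'a set \<Rightarrow> 'a"
    and W :: "'a \<Rightarrow> real"
    and \<rho> :: "nat \<Rightarrow> 'a set \<Rightarrow> real"
    and h \<kappa> \<delta>t C_iso :: real
  assumes "bounded_smooth_domain \<Omega>"
    and "voronoi_mesh \<Omega> h T gen"
    and "\<kappa> > 0" and "\<delta>t > 0"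
    and "\<And>x. W x = W (- x)" and "\<And>x. W x \<ge> 0"
    and "Ck_on 1 W (UNIV - {0})"
    and "\<exists>C. C-lipschitz_on UNIV W"
    and "\<And>K. K \<in> T \<Longrightarrow> area (frontier K) / vol K \<le> C_iso / h"
    and "SG_solution \<kappa> \<delta>t W T gen \<rho>"
    and "\<rho> 0 \<in> discrete_prob T"
    and "Lip W = 0 \<or> h \<le> \<kappa> / Lip W"
    and "64 * C_iso * (Lip W ^ 2 * free_energy \<kappa> W T gen (\<rho> 0) / \<kappa> ^ 2) * \<delta>t
         + 512 * C_iso ^ 2 * (Lip W ^ 4 / \<kappa> ^ 2) * \<delta>t ^ 2 \<le> 1"
    and "\<delta>t * (Lip W ^ 2 / \<kappa>) \<le> 3 / 8"
  shows "(\<lambda>n. l1_setdist T (\<rho> n) (stationary_solutions \<kappa> \<delta>t W T gen)) \<longlonglongrightarrow> 0"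
proof (rule SG_scheme.setdist_stationary_tendsto_0[OF SG_scheme_voronoi_mesh])
  show "voronoi_mesh \<Omega> h T gen" by (rule assms)
qed (rule assms)+

end
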